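(* Let the highly robust KKT condition for $(P_{\mathcal{U}})$ be satisfied at $\bar{x}\in\Omega$. If $(f,g)$ is generalized locally convex at $\bar{x}$, then $\bar{x}$ is a local highly robust weakly efficient solution of $(P_{\mathcal{U}})$.
   Context: Setting: $X$ is a real Banach space with dual $X^*$ and pairing $\langle\cdot,\cdot\rangle$; $p\ge 2$, $I=\{1,\dots,p\}$, $J=\{1,\dots,q\}$; $f=(f_1,\dots,f_p):X\to\mathbb{R}^p$; $\mathcal{U}_i\subseteq X^*$ nonempty, $\mathcal{U}=\prod_{i=1}^p\mathcal{U}_i$; each $\mathcal{V}_j$ is a nonempty set with a Hausdorff topology and $g_j:X\times\mathcal{V}_j\to[-\infty,\infty]$ is proper (never $-\infty$, not identically $+\infty$). The robust feasible set is $\Omega=\{x\in X: g_j(x,v_j)\le0\ \forall v_j\in\mathcal{V}_j,\ \forall j\in J\}$. For $u\in\mathcal{U}$, $f_i(x,u_i)=f_i(x)-\langle u_i,x\rangle$, $f(x,u)=(f_1(x,u_1),\dots,f_p(x,u_p))$; $(P_u)$ is: minimize $f(x,u)$ over $x\in\Omega$; $(P_{\mathcal{U}})$ is the family $(P_u)_{u\in\mathcal{U}}$. For $a,b\in\mathbb{R}^p$, $a<b$ iff $a_i<b_i$ for all $i$. $\bar x\in\Omega$ is a local highly robust weakly efficient solution of $(P_{\mathcal{U}})$ if there is a neighbourhood $\mathcal{B}$ of $\bar x$ such that for every $u\in\mathcal{U}$ there is no $x\in\Omega\cap\mathcal{B}$ with $f(x,u)<f(\bar x,u)$. $\mathcal{V}_j(\bar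 x)=\{v_j\in\mathcal{V}_j:g_j(\bar x,v_j)=\sup_{v\in\mathcal{V}_j}g_j(\bar x,v)\}$. $\mathrm{co}$ is convex hull, $\mathrm{cl}^*$ is weak$^*$ closure in $X^*$. Mordukhovich subdifferential: for a set $S$ in a Banach space $Z$, $z\in S$ and $\varepsilon\ge0$, $\widehat N_\varepsilon(z;S)=\{z^*\in Z^*:\limsup_{w\to z,\,w\in S}\langle z^*,w-z\rangle/\Vert w-z\Vert\le\varepsilon\}$; $N(\bar z;S)$ is the set of $z^*\in Z^*$ for which there are sequences $\varepsilon_\nu\downarrow0$, $z_\nu\to\bar z$ in $S$, $z^*_\nu\in\widehat N_{\varepsilon_\nu}(z_\nu;S)$ with $z_\nu^*\to z^*$ weak$^*$. For $\varphi$ finite at $\bar x$, $\partial\varphi(\bar x)=\{x^*\in X^*:(x^*,-1)\in N((\bar x,\varphi(\bar x));\mathrm{epi}\,\varphi)\}$. $\partial_xf_i(\bar x,u_i)$ and $\partial_xg_j(\bar x,v_j)$ are the Mordukhovich subdifferentials at $\bar x$ of $f_i(\cdot,u_i)$ and $g_j(\cdot,v_j)$. Highly robust KKT condition at $\bar x$: for each $u\in\mathcal{U}$ there exist $\lambda_i\ge0$, $i\in I$, with $\sum_{i=1}^p\lambda_i=1$, and $\mu_j\ge0$, $j\in J$, such that $$\sum_{i=1}^p\lambda_iu_i\in\sum_{i=1}^p\lambda_i\partial f_i(\bar x)+\sum_{j=1}^q\mu_j\,\mathrm{cl}^*\mathrm{co}\Big(\bigcup_{v_j\in\mathcal{V}_j(\bar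 x)}\partial_xg_j(\bar x,v_j)\Big)$$ and $\mu_j\sup_{v_j\in\mathcal{V}_j}g_j(\bar x,v_j)=0$ for all $j\in J$. $(f,g)$ is generalized locally convex at $\bar x$ if there is a neighbourhood $\mathcal{B}$ of $\bar x$ such that for each $x\in\Omega\cap\mathcal{B}$ and each $u\in\mathcal{U}$ there exists $d\in X$ with $\langle x_i^*,d\rangle\le f_i(x,u_i)-f_i(\bar x,u_i)$ for all $x_i^*\in\partial_xf_i(\bar x,u_i)$, $i\in I$, and $\langle x_j^*,d\rangle\le g_j(x,v_j)-g_j(\bar x,v_j)$ for all $x_j^*\in\partial_xg_j(\bar x,v_j)$, $v_j\in\mathcal{V}_j(\bar x)$, $j\in J$. *)

theory Defs
  imports "HOL-Analysis.Analysis"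
begin

section \<open>Variational analysis\<close>

text \<open>For functionals on a normed space the strong operator topology (pointwise convergence)
  is the weak-star topology of the dual.\<close>

abbreviation weak_star :: "('z::real_normed_vector \<Rightarrow>\<^sub>L real) topology" where
  "weak_star \<equiv> strong_operator_topology"

text \<open>The filter \<open>at z within S\<close> omits \<open>z\<close> itself; at an isolated point of \<open>S\<close> the upper limit
  is \<open>-\<infinity>\<close>, so every functional is an \<open>\<epsilon>\<close>-normal there.\<close>

definition eps_normals ::
  "real \<Rightarrow> 'z::real_normed_vector \<Rightarrow> 'z set \<Rightarrow> ('z \<Rightarrow>\<^sub>L real) set" where
  "eps_normals \<epsilon> z S =
     {zs. Limsup (at z within S) (\<lambda>w. ereal (blinfun_apply zs (w - z) / norm (w - z))) \<le> ereal \<epsilon>}"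

definition normal_cone :: "'z::real_normed_vector \<Rightarrow> 'z set \<Rightarrow> ('z \<Rightarrow>\<^sub>L real) set" where
  "normal_cone zbar S =
     {zs. \<exists>(\<epsilon> :: nat \<Rightarrow> real) (z :: nat \<Rightarrow> 'z) (\<zeta> :: nat \<Rightarrow> 'z \<Rightarrow>\<^sub>L real).
        (\<forall>n. 0 \<le> \<epsilon> n) \<and> decseq \<epsilon> \<and> \<epsilon> \<longlonglongrightarrow> 0 \<and>
        (\<forall>n. z n \<in> S) \<and> z \<longlonglongrightarrow> zbar \<and>
        (\<forall>n. \<zeta> n \<in> eps_normals (\<epsilon> n) (z n) S) \<and>
        limitin weak_star \<zeta> zs sequentially}"

definition epi :: "('x \<Rightarrow> ereal) \<Rightarrow> ('x \<times> real) set" where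
  "epi \<phi> = {(x, r). \<phi> x \<le> ereal r}"

text \<open>The pair \<open>(xs, r)\<close> as a functional on the product space.\<close>

definition dual_pair ::
  "('x::real_normed_vector \<Rightarrow>\<^sub>L real) \<Rightarrow> real \<Rightarrow> ('x \<times> real) \<Rightarrow>\<^sub>L real" where
  "dual_pair xs r = (xs o\<^sub>L fst_blinfun) + r *\<^sub>R snd_blinfun"

lemma dual_pair_apply [simp]:
  "blinfun_apply (dual_pair xs r) (x, t) = blinfun_apply xs x + r * t"
  by (simp add: dual_pair_def blinfun.bilinear_simps)

text \<open>The norm on \<open>'x \<times> real\<close> is the Euclidean combination of the two norms. The normal cone does
  not change under passage to an equivalent norm. The subdifferential is empty where \<open>\<phi>\<close> is
  infinite.\<close>

definition subdifferential ::
  "('x::real_normed_vector \<Rightarrow> ereal) \<Rightarrow> 'x \<Rightarrow> ('x \<Rightarrow>\<^sub>L real) set" where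
  "subdifferential \<phi> xbar =
     {xs. \<bar>\<phi> xbar\<bar> \<noteq> \<infinity> \<and>
          dual_pair xs (-1) \<in> normal_cone (xbar, real_of_ereal (\<phi> xbar)) (epi \<phi>)}"

section \<open>The uncertain multiobjective problem\<close>

text \<open>Objectives are indexed by a finite type \<open>'p\<close>, constraints by \<open>{1..q}\<close>. The uncertainty sets of
  the constraints are the carriers of topologies \<open>V j\<close> over one type \<open>'v\<close>; finitely many
  unrelated spaces embed into a common sum type.\<close>

definition vec_less :: "real ^ 'p \<Rightarrow> real ^ 'p \<Rightarrow> bool" where
  "vec_less a b \<longleftrightarrow> (\<forall>i. a $ i < b $ i)"

definition uncertainty_set ::
  "('p::finite \<Rightarrow> ('x::real_normed_vector \<Rightarrow>\<^sub>L real) set) \<Rightarrow> (('x \<Rightarrow>\<^sub>L real) ^ 'p) set" where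
  "uncertainty_set U = {u. \<forall>i. u $ i \<in> U i}"

definition perturbed ::
  "('x::real_normed_vector \<Rightarrow> real ^ 'p) \<Rightarrow> 'x \<Rightarrow> ('x \<Rightarrow>\<^sub>L real) ^ 'p \<Rightarrow> real ^ 'p" where
  "perturbed f x u = (\<chi> i. f x $ i - blinfun_apply (u $ i) x)"

definition proper_on :: "'v set \<Rightarrow> ('x \<Rightarrow> 'v \<Rightarrow> ereal) \<Rightarrow> bool" where
  "proper_on W h \<longleftrightarrow>
     (\<forall>x. \<forall>v\<in>W. h x v \<noteq> -\<infinity>) \<and> (\<exists>x. \<exists>v\<in>W. h x v \<noteq> \<infinity>)"

definition robust_feasible ::
  "nat \<Rightarrow> (nat \<Rightarrow> 'v topology) \<Rightarrow> (nat \<Rightarrow> 'x \<Rightarrow> 'v \<Rightarrow> ereal) \<Rightarrow> 'x set" where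
  "robust_feasible q V g = {x. \<forall>j\<in>{1..q}. \<forall>v\<in>topspace (V j). g j x v \<le> 0}"

definition worst_value :: "'v topology \<Rightarrow> ('x \<Rightarrow> 'v \<Rightarrow> ereal) \<Rightarrow> 'x \<Rightarrow> ereal" where
  "worst_value W h x = (SUP v\<in>topspace W. h x v)"

definition active_set :: "'v topology \<Rightarrow> ('x \<Rightarrow> 'v \<Rightarrow> ereal) \<Rightarrow> 'x \<Rightarrow> 'v set" where
  "active_set W h x = {v \<in> topspace W. h x v = worst_value W h x}"

definition local_highly_robust_weakly_efficient ::
  "('x::real_normed_vector \<Rightarrow> real ^ 'p::finite) \<Rightarrow> ('p \<Rightarrow> ('x \<Rightarrow>\<^sub>L real) set) \<Rightarrow>
   nat \<Rightarrow> (nat \<Rightarrow> 'v topology) \<Rightarrow> (nat \<Rightarrow> 'x \<Rightarrow> 'v \<Rightarrow> ereal) \<Rightarrow> 'x \<Rightarrow> bool" where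
  "local_highly_robust_weakly_efficient f U q V g xbar \<longleftrightarrow>
     xbar \<in> robust_feasible q V g \<and>
     (\<exists>B. open B \<and> xbar \<in> B \<and>
        (\<forall>u\<in>uncertainty_set U.
           \<not> (\<exists>x\<in>robust_feasible q V g \<inter> B.
                vec_less (perturbed f x u) (perturbed f xbar u))))"

text \<open>Sums of sets are Minkowski sums and multiples are images. In particular a multiple of the
  empty set is empty, also for the multiplier 0.\<close>

definition highly_robust_KKT ::
  "('x::real_normed_vector \<Rightarrow> real ^ 'p::finite) \<Rightarrow> ('p \<Rightarrow> ('x \<Rightarrow>\<^sub>L real) set) \<Rightarrow>
   nat \<Rightarrow> (nat \<Rightarrow> 'v topology) \<Rightarrow> (nat \<Rightarrow> 'x \<Rightarrow> 'v \<Rightarrow> ereal) \<Rightarrow> 'x \<Rightarrow> bool" where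
  "highly_robust_KKT f U q V g xbar \<longleftrightarrow>
     (\<forall>u\<in>uncertainty_set U.
        \<exists>(lam :: 'p \<Rightarrow> real) (mu :: nat \<Rightarrow> real).
          (\<forall>i. 0 \<le> lam i) \<and> (\<Sum>i\<in>UNIV. lam i) = 1 \<and> (\<forall>j\<in>{1..q}. 0 \<le> mu j) \<and>
          (\<Sum>i\<in>UNIV. lam i *\<^sub>R (u $ i)) \<in>
             (\<Sum>i\<in>UNIV. (\<lambda>y. lam i *\<^sub>R y) ` subdifferential (\<lambda>x. ereal (f x $ i)) xbar) +
             (\<Sum>j\<in>{1..q}. (\<lambda>y. mu j *\<^sub>R y) `
                (weak_star closure_of
                   (convex hull (\<Union>v\<in>active_set (V j) (g j) xbar.
                                    subdifferential (\<lambda>x. g j x v) xbar)))) \<and>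
          (\<forall>j\<in>{1..q}. ereal (mu j) * worst_value (V j) (g j) xbar = 0))"

definition generalized_locally_convex ::
  "('x::real_normed_vector \<Rightarrow> real ^ 'p::finite) \<Rightarrow> ('p \<Rightarrow> ('x \<Rightarrow>\<^sub>L real) set) \<Rightarrow>
   nat \<Rightarrow> (nat \<Rightarrow> 'v topology) \<Rightarrow> (nat \<Rightarrow> 'x \<Rightarrow> 'v \<Rightarrow> ereal) \<Rightarrow> 'x \<Rightarrow> bool" where
  "generalized_locally_convex f U q V g xbar \<longleftrightarrow>
     (\<exists>B. open B \<and> xbar \<in> B \<and>
        (\<forall>x\<in>robust_feasible q V g \<inter> B. \<forall>u\<in>uncertainty_set U. \<exists>d.
           (\<forall>i. \<forall>xs\<in>subdifferential (\<lambda>y. ereal (perturbed f y u $ i)) xbar.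
              blinfun_apply xs d \<le> perturbed f x u $ i - perturbed f xbar u $ i) \<and>
           (\<forall>j\<in>{1..q}. \<forall>v\<in>active_set (V j) (g j) xbar.
              \<forall>xs\<in>subdifferential (\<lambda>y. g j y v) xbar.
                ereal (blinfun_apply xs d) \<le> g j x v - g j xbar v)))"

end

theory Submission
  imports Defs
begin

text \<open>
  The proof is the scalar duality argument behind every sufficient optimality condition, run for
  each scenario \<open>u\<close> separately. Suppose a feasible \<open>x\<close> near \<open>xbar\<close> were strictly better than
  \<open>xbar\<close> in all components of the perturbed objective, and let \<open>d\<close> be the direction that
  generalized local convexity supplies for \<open>x\<close> and \<open>u\<close>. Apply the functional identity in the KKT
  condition, \<open>\<Sum> \<lambda>\<^sub>i u\<^sub>i = \<Sum> \<lambda>\<^sub>i \<xi>\<^sub>i + \<Sum> \<mu>\<^sub>j \<eta>\<^sub>j\<close>, to \<open>d\<close>.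
  The terms \<open>\<lambda>\<^sub>i (\<xi>\<^sub>i - u\<^sub>i) d\<close> are bounded by
  \<open>\<lambda>\<^sub>i\<close> times the change of the \<open>i\<close>-th perturbed objective, so their sum is negative. Each term
  \<open>\<mu>\<^sub>j \<eta>\<^sub>j d\<close> is nonpositive: if \<open>\<mu>\<^sub>j \<noteq> 0\<close> then complementarity makes the active
  constraints vanish at \<open>xbar\<close>, while they are nonpositive at \<open>x\<close>. So \<open>0\<close> is the sum
  of a negative and a nonpositive number, which is absurd.

  Two steps need an argument. The KKT condition speaks of \<open>\<partial>f\<^sub>i\<close>, the convexity condition of the
  subdifferential of the tilted function \<open>f\<^sub>i - u\<^sub>i\<close>; the passage between them is
  \<open>subdifferential_tilt\<close>. Tilting a function shears its epigraph, and normal cones are transported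
  by linear homeomorphisms (\<open>normal_cone_linear_image\<close>), because such a map turns an
  \<open>\<epsilon>\<close>-normal into a \<open>C \<epsilon>\<close>-normal with a constant \<open>C\<close>. Secondly, \<open>\<eta>\<^sub>j\<close> lies only in the weak-star closed
  convex hull of the active subgradients; but a bound on the values at a fixed \<open>d\<close> defines a
  weak-star closed half-space, so it passes to that hull
  (\<open>weak_star_closed_convex_hull_bound\<close>).
\<close>

section \<open>Normal cones under linear homeomorphisms\<close>

text \<open>The denominator can be cleared because the filter excludes the point \<open>z\<close>, where it vanishes.\<close>

lemma eps_normals_iff_eventually:
  "zs \<in> eps_normals \<epsilon> z S \<longleftrightarrow>
     (\<forall>\<delta>>0. \<forall>\<^sub>F w in at z within S. blinfun_apply zs (w - z) < (\<epsilon> + \<delta>) * norm (w - z))"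
proof -
  let ?Q = "\<lambda>w. blinfun_apply zs (w - z) / norm (w - z)"
  have "zs \<in> eps_normals \<epsilon> z S \<longleftrightarrow>
      (\<forall>y > ereal \<epsilon>. \<forall>\<^sub>F w in at z within S. ereal (?Q w) < y)"
    by (simp add: eps_normals_def Limsup_le_iff)
  also have "\<dots> \<longleftrightarrow> (\<forall>\<delta>>0. \<forall>\<^sub>F w in at z within S. ?Q w < \<epsilon> + \<delta>)"
  proof (intro iffI allI impI)
    fix \<delta> :: real
    assume "\<forall>y > ereal \<epsilon>. \<forall>\<^sub>F w in at z within S. ereal (?Q w) < y" and "0 < \<delta>"
    from this(1)[rule_format, of "ereal (\<epsilon> + \<delta>)"] this(2)
    show "\<forall>\<^sub>F w in at z within S. ?Q w < \<epsilon> + \<delta>" by simp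
  next
    fix y :: ereal
    assume small: "\<forall>\<delta>>0. \<forall>\<^sub>F w in at z within S. ?Q w < \<epsilon> + \<delta>" and y: "ereal \<epsilon> < y"
    show "\<forall>\<^sub>F w in at z within S. ereal (?Q w) < y"
    proof (cases y)
      case (real r)
      then have "\<forall>\<^sub>F w in at z within S. ?Q w < \<epsilon> + (r - \<epsilon>)"
        using small y by (metis diff_gt_0_iff_gt less_ereal.simps(1))
      then show ?thesis by (simp add: real)
    qed (use y in auto)
  qed
  also have "\<dots> \<longleftrightarrow> (\<forall>\<delta>>0. \<forall>\<^sub>F w in at z within S.
      blinfun_apply zs (w - z) < (\<epsilon> + \<delta>) * norm (w - z))"
    by (intro all_cong eventually_cong refl)
      (auto simp: eventually_at_filter divide_less_eq)
  finally show ?thesis .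
qed

text \<open>Since \<open>\<parallel>B (w - A z)\<parallel> \<le> \<parallel>B\<parallel> \<parallel>w - A z\<parallel>\<close>, composing with the inverse \<open>B\<close> multiplies the
  difference quotients by at most \<open>\<parallel>B\<parallel>\<close>. The added 1 keeps the factor positive without a
  separate treatment of the trivial space.\<close>

lemma eps_normals_linear_image:
  fixes A :: "'a::real_normed_vector \<Rightarrow>\<^sub>L 'b::real_normed_vector"
    and B :: "'b \<Rightarrow>\<^sub>L 'a"
  assumes BA: "\<And>x. blinfun_apply B (blinfun_apply A x) = x"
    and AB: "\<And>y. blinfun_apply A (blinfun_apply B y) = y"
    and "0 \<le> \<epsilon>" and zs: "zs \<in> eps_normals \<epsilon> z S"
  shows "zs o\<^sub>L B \<in> eps_normals (\<epsilon> * (norm B + 1)) (blinfun_apply A z) (blinfun_apply A ` S)"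
  unfolding eps_normals_iff_eventually
proof (intro allI impI)
  fix \<delta> :: real
  assume "0 < \<delta>"
  define K where "K = norm B + 1"
  have "0 < K" unfolding K_def by (simp add: add_nonneg_pos)
  let ?F = "at (blinfun_apply A z) within blinfun_apply A ` S"
  have "((\<lambda>w. w) \<longlongrightarrow> blinfun_apply A z) ?F" by (rule tendsto_ident_at)
  then have "(blinfun_apply B \<longlongrightarrow> blinfun_apply B (blinfun_apply A z)) ?F"
    by (intro blinfun.tendsto tendsto_const)
  moreover have "\<forall>\<^sub>F w in ?F. blinfun_apply B w \<in> S \<and> blinfun_apply B w \<noteq> z"
    unfolding eventually_at_filter by (rule always_eventually) (use BA AB in auto)
  ultimately have lim: "filterlim (blinfun_apply B) (at z within S) ?F"
    by (simp add: filterlim_at BA)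
  have "\<forall>\<^sub>F w in at z within S. blinfun_apply zs (w - z) < (\<epsilon> + \<delta> / K) * norm (w - z)"
    using zs \<open>0 < \<delta>\<close> \<open>0 < K\<close> by (simp add: eps_normals_iff_eventually)
  from filterlim_iff[THEN iffD1, OF lim, rule_format, OF this]
  show "\<forall>\<^sub>F w in ?F. blinfun_apply (zs o\<^sub>L B) (w - blinfun_apply A z)
      < (\<epsilon> * (norm B + 1) + \<delta>) * norm (w - blinfun_apply A z)"
  proof eventually_elim
    case (elim w)
    have shift: "blinfun_apply B (w - blinfun_apply A z) = blinfun_apply B w - z"
      by (simp add: blinfun.diff_right BA)
    have "norm (blinfun_apply B w - z) \<le> norm B * norm (w - blinfun_apply A z)"
      using norm_blinfun[of B "w - blinfun_apply A z"] by (simp add: shift)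
    also have "\<dots> \<le> K * norm (w - blinfun_apply A z)"
      unfolding K_def by (rule mult_right_mono) auto
    finally have "(\<epsilon> + \<delta> / K) * norm (blinfun_apply B w - z)
        \<le> (\<epsilon> + \<delta> / K) * (K * norm (w - blinfun_apply A z))"
      using \<open>0 \<le> \<epsilon>\<close> \<open>0 < \<delta>\<close> \<open>0 < K\<close> by (intro mult_left_mono) auto
    also have "\<dots> = (\<epsilon> * K + \<delta>) * norm (w - blinfun_apply A z)"
      using \<open>0 < K\<close> by (simp add: field_simps)
    finally show ?case using elim by (simp add: shift K_def)
  qed
qed

lemma continuous_map_weak_star_precompose:
  "continuous_map weak_star weak_star (\<lambda>zs. zs o\<^sub>L B)"
  by (simp add: continuous_on_strong_operator_topo_iff_coordinatewise
      strong_operator_topology_continuous_evaluation)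

text \<open>The constant factor of the previous estimate is absorbed by \<open>\<epsilon>\<^sub>n \<longlonglongrightarrow> 0\<close>, and
  precomposition with \<open>B\<close> preserves weak-star limits.\<close>

lemma normal_cone_linear_image:
  fixes A :: "'a::real_normed_vector \<Rightarrow>\<^sub>L 'b::real_normed_vector"
    and B :: "'b \<Rightarrow>\<^sub>L 'a"
  assumes BA: "\<And>x. blinfun_apply B (blinfun_apply A x) = x"
    and AB: "\<And>y. blinfun_apply A (blinfun_apply B y) = y"
    and "zs \<in> normal_cone z S"
  shows "zs o\<^sub>L B \<in> normal_cone (blinfun_apply A z) (blinfun_apply A ` S)"
proof -
  from assms(3) obtain \<epsilon> y \<zeta> where
    eps: "\<And>n. 0 \<le> \<epsilon> n" "decseq \<epsilon>" "\<epsilon> \<longlonglongrightarrow> 0"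
    and y: "\<And>n. y n \<in> S" "y \<longlonglongrightarrow> z"
    and normals: "\<And>n. \<zeta> n \<in> eps_normals (\<epsilon> n) (y n) S"
    and lim: "limitin weak_star \<zeta> zs sequentially"
    unfolding normal_cone_def by blast
  let ?K = "norm B + 1"
  have "0 \<le> ?K" by simp
  show ?thesis
    unfolding normal_cone_def
  proof (intro CollectI exI conjI allI)
    show "0 \<le> \<epsilon> n * ?K" for n using eps(1) \<open>0 \<le> ?K\<close> by (rule mult_nonneg_nonneg)
    show "decseq (\<lambda>n. \<epsilon> n * ?K)"
      using eps(2) \<open>0 \<le> ?K\<close> by (auto simp: decseq_def intro: mult_right_mono)
    show "(\<lambda>n. \<epsilon> n * ?K) \<longlonglongrightarrow> 0" using eps(3) by (rule tendsto_mult_left_zero)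
    show "blinfun_apply A (y n) \<in> blinfun_apply A ` S" for n using y(1) by (rule imageI)
    show "(\<lambda>n. blinfun_apply A (y n)) \<longlonglongrightarrow> blinfun_apply A z"
      using y(2) by (intro blinfun.tendsto tendsto_const)
    show "\<zeta> n o\<^sub>L B
        \<in> eps_normals (\<epsilon> n * ?K) (blinfun_apply A (y n)) (blinfun_apply A ` S)" for n
      by (rule eps_normals_linear_image[OF BA AB eps(1) normals])
    show "limitin weak_star (\<lambda>n. \<zeta> n o\<^sub>L B) (zs o\<^sub>L B) sequentially"
      using continuous_map_limit[OF continuous_map_weak_star_precompose lim]
      by (simp add: o_def)
  qed
qed

section \<open>Subdifferentials of tilted functions\<close>

definition shear ::
  "('x::real_normed_vector \<Rightarrow>\<^sub>L real) \<Rightarrow> ('x \<times> real) \<Rightarrow>\<^sub>L ('x \<times> real)" where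
  "shear a = Blinfun (\<lambda>z. (fst z, snd z + blinfun_apply a (fst z)))"

lemma shear_apply [simp]:
  "blinfun_apply (shear a) z = (fst z, snd z + blinfun_apply a (fst z))"
proof -
  have "bounded_linear (\<lambda>z. (fst z, snd z + blinfun_apply a (fst z)))"
    by (intro bounded_linear_intros)
  then show ?thesis by (simp add: shear_def bounded_linear_Blinfun_apply)
qed

lemma shear_image_epi:
  "blinfun_apply (shear (- a)) ` epi \<phi> = epi (\<lambda>x. \<phi> x - ereal (blinfun_apply a x))"
proof (intro equalityI subsetI)
  fix z assume "z \<in> blinfun_apply (shear (- a)) ` epi \<phi>"
  then obtain x r where "\<phi> x \<le> ereal r" and "z = (x, r - blinfun_apply a x)"
    by (auto simp: epi_def blinfun.minus_left)
  then show "z \<in> epi (\<lambda>x. \<phi> x - ereal (blinfun_apply a x))"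
    by (cases "\<phi> x") (auto simp: epi_def)
next
  fix z assume "z \<in> epi (\<lambda>x. \<phi> x - ereal (blinfun_apply a x))"
  then obtain x r where "\<phi> x - ereal (blinfun_apply a x) \<le> ereal r" and z: "z = (x, r)"
    by (auto simp: epi_def)
  then have "(x, r + blinfun_apply a x) \<in> epi \<phi>"
    by (cases "\<phi> x") (auto simp: epi_def)
  moreover have "z = blinfun_apply (shear (- a)) (x, r + blinfun_apply a x)"
    by (simp add: z blinfun.minus_left)
  ultimately show "z \<in> blinfun_apply (shear (- a)) ` epi \<phi>" by blast
qed

text \<open>The epigraph of the tilted function is the image of \<open>epi \<phi>\<close> under \<open>shear (- a)\<close>, and
  composing the normal \<open>(xs, -1)\<close> with the inverse shear gives \<open>(xs - a, -1)\<close>: the last component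
  stays \<open>-1\<close>, so the new normal is again of subgradient form.\<close>

lemma subdifferential_tilt:
  assumes "xs \<in> subdifferential \<phi> xbar"
  shows "xs - a \<in> subdifferential (\<lambda>x. \<phi> x - ereal (blinfun_apply a x)) xbar"
proof -
  let ?\<psi> = "\<lambda>x. \<phi> x - ereal (blinfun_apply a x)"
  have fin: "\<bar>\<phi> xbar\<bar> \<noteq> \<infinity>"
    and normal: "dual_pair xs (- 1) \<in> normal_cone (xbar, real_of_ereal (\<phi> xbar)) (epi \<phi>)"
    using assms by (auto simp: subdifferential_def)
  have "dual_pair xs (- 1) o\<^sub>L shear a
      \<in> normal_cone (blinfun_apply (shear (- a)) (xbar, real_of_ereal (\<phi> xbar)))
           (blinfun_apply (shear (- a)) ` epi \<phi>)"
    by (rule normal_cone_linear_image[OF _ _ normal]) (auto simp: blinfun.minus_left)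
  moreover have "dual_pair xs (- 1) o\<^sub>L shear a = dual_pair (xs - a) (- 1)"
    by (rule blinfun_eqI) (auto simp: blinfun.diff_left)
  moreover have "blinfun_apply (shear (- a)) (xbar, real_of_ereal (\<phi> xbar))
      = (xbar, real_of_ereal (?\<psi> xbar))"
    using fin by (cases "\<phi> xbar") (auto simp: blinfun.minus_left)
  moreover have "\<bar>?\<psi> xbar\<bar> \<noteq> \<infinity>"
    using fin by (cases "\<phi> xbar") auto
  ultimately show ?thesis by (simp only: subdifferential_def mem_Collect_eq shear_image_epi) simp
qed

section \<open>The active constraints\<close>

text \<open>The functionals that are at most \<open>c\<close> at \<open>d\<close> form a half-space that is convex and, as a
  preimage under an evaluation map, weak-star closed.\<close>

lemma weak_star_closed_convex_hull_bound:
  assumes bound: "\<And>xs. xs \<in> S \<Longrightarrow> blinfun_apply xs d \<le> c"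
    and ys: "ys \<in> weak_star closure_of (convex hull S)"
  shows "blinfun_apply ys d \<le> c"
proof -
  let ?H = "{xs. blinfun_apply xs d \<le> c}"
  have "?H = (\<lambda>xs. blinfun_apply xs d) -` {..c}" by auto
  moreover have "linear (\<lambda>xs. blinfun_apply xs d)"
    by (intro bounded_linear.linear bounded_linear_intros)
  ultimately have "convex ?H"
    using convex_linear_vimage[of "\<lambda>xs. blinfun_apply xs d" "{..c}"] by simp
  then have "convex hull S \<subseteq> ?H" using bound by (intro hull_minimal) auto
  moreover have "closedin weak_star ?H"
    using closedin_continuous_map_preimage
        [OF strong_operator_topology_continuous_evaluation[of d], of "{..c}"]
    by (simp add: strong_operator_topology_topspace)
  ultimately have "weak_star closure_of (convex hull S) \<subseteq> ?H" by (rule closure_of_minimal)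
  then show ?thesis using ys by blast
qed

text \<open>By complementarity a positive multiplier forces the worst value at \<open>xbar\<close> to be 0, so on the
  active scenarios the bound \<open>g x v - g xbar v\<close> equals \<open>g x v\<close>, which is nonpositive by
  feasibility.\<close>

lemma multiplier_times_active_subgradient_nonpos:
  assumes "0 \<le> \<mu>"
    and compl: "ereal \<mu> * worst_value W h xbar = 0"
    and feasible: "\<And>v. v \<in> topspace W \<Longrightarrow> h x v \<le> 0"
    and bound: "\<And>v xs. v \<in> active_set W h xbar \<Longrightarrow> xs \<in> subdifferential (\<lambda>y. h y v) xbar \<Longrightarrow>
      ereal (blinfun_apply xs d) \<le> h x v - h xbar v"
    and ys: "ys \<in> weak_star closure_of
      (convex hull (\<Union>v\<in>active_set W h xbar. subdifferential (\<lambda>y. h y v) xbar))"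
  shows "\<mu> * blinfun_apply ys d \<le> 0"
proof (cases "\<mu> = 0")
  case False
  then have worst: "worst_value W h xbar = 0" using compl by simp
  have "blinfun_apply ys d \<le> 0"
  proof (rule weak_star_closed_convex_hull_bound[OF _ ys])
    fix xs assume "xs \<in> (\<Union>v\<in>active_set W h xbar. subdifferential (\<lambda>y. h y v) xbar)"
    then obtain v where v: "v \<in> active_set W h xbar"
      and xs: "xs \<in> subdifferential (\<lambda>y. h y v) xbar" by blast
    have "h xbar v = 0" and "h x v \<le> 0"
      using v worst feasible by (auto simp: active_set_def)
    then have "ereal (blinfun_apply xs d) \<le> 0"
      using bound[OF v xs] by (metis diff_zero order_trans ereal_minus(7) zero_ereal_def)
    then show "blinfun_apply xs d \<le> 0" by (simp add: zero_ereal_def)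
  qed
  then show ?thesis using \<open>0 \<le> \<mu>\<close> by (rule mult_nonneg_nonpos[rotated])
qed simp

section \<open>Sufficiency of the KKT condition\<close>

lemma sum_convex_weights_neg:
  fixes l c :: "'i \<Rightarrow> real"
  assumes "finite I" and "\<And>i. i \<in> I \<Longrightarrow> 0 \<le> l i" and "sum l I = 1"
    and neg: "\<And>i. i \<in> I \<Longrightarrow> c i < 0"
  shows "(\<Sum>i\<in>I. l i * c i) < 0"
proof -
  obtain k where k: "k \<in> I" "0 < l k"
    using assms(2,3) by (metis less_eq_real_def sum.neutral zero_neq_one)
  have "(\<Sum>i\<in>I. l i * c i) < (\<Sum>i\<in>I. 0)"
  proof (rule sum_strict_mono_ex1[OF \<open>finite I\<close>])
    show "\<forall>i\<in>I. l i * c i \<le> 0" using assms(2) neg by (simp add: mult_nonneg_nonpos less_imp_le)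
    show "\<exists>i\<in>I. l i * c i < 0" using k neg by (blast intro: mult_pos_neg)
  qed
  then show ?thesis by simp
qed

theorem theorem13:
  fixes f :: "'x::banach \<Rightarrow> real ^ 'p::finite"
    and U :: "'p \<Rightarrow> ('x \<Rightarrow>\<^sub>L real) set"
    and q :: nat
    and V :: "nat \<Rightarrow> 'v topology"
    and g :: "nat \<Rightarrow> 'x \<Rightarrow> 'v \<Rightarrow> ereal"
    and xbar :: 'x
  assumes "2 \<le> CARD('p)"
    and "\<And>i. U i \<noteq> {}"
    and "\<And>j. j \<in> {1..q} \<Longrightarrow> topspace (V j) \<noteq> {}"
    and "\<And>j. j \<in> {1..q} \<Longrightarrow> Hausdorff_space (V j)"
    and "\<And>j. j \<in> {1..q} \<Longrightarrow> proper_on (topspace (V j)) (g j)"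
    and "xbar \<in> robust_feasible q V g"
    and "highly_robust_KKT f U q V g xbar"
    and "generalized_locally_convex f U q V g xbar"
  shows "local_highly_robust_weakly_efficient f U q V g xbar"
proof -
  from assms(8) obtain B where B: "open B" "xbar \<in> B"
    and glc: "\<And>x u. x \<in> robust_feasible q V g \<inter> B \<Longrightarrow> u \<in> uncertainty_set U \<Longrightarrow> \<exists>d.
      (\<forall>i. \<forall>xs\<in>subdifferential (\<lambda>y. ereal (perturbed f y u $ i)) xbar.
         blinfun_apply xs d \<le> perturbed f x u $ i - perturbed f xbar u $ i) \<and>
      (\<forall>j\<in>{1..q}. \<forall>v\<in>active_set (V j) (g j) xbar.
         \<forall>xs\<in>subdifferential (\<lambda>y. g j y v) xbar.
           ereal (blinfun_apply xs d) \<le> g j x v - g j xbar v)"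
    unfolding generalized_locally_convex_def by blast
  have "\<not> vec_less (perturbed f x u) (perturbed f xbar u)"
    if u: "u \<in> uncertainty_set U" and x: "x \<in> robust_feasible q V g \<inter> B" for u x
  proof
    assume better: "vec_less (perturbed f x u) (perturbed f xbar u)"
    let ?df = "\<lambda>i. subdifferential (\<lambda>x. ereal (f x $ i)) xbar"
    let ?dg = "\<lambda>j. weak_star closure_of (convex hull
      (\<Union>v\<in>active_set (V j) (g j) xbar. subdifferential (\<lambda>x. g j x v) xbar))"
    from assms(7) u obtain lam :: "'p \<Rightarrow> real" and mu :: "nat \<Rightarrow> real" where
      lam: "\<And>i. 0 \<le> lam i" "(\<Sum>i\<in>UNIV. lam i) = 1"
      and mu: "\<And>j. j \<in> {1..q} \<Longrightarrow> 0 \<le> mu j"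
      and incl: "(\<Sum>i\<in>UNIV. lam i *\<^sub>R (u $ i)) \<in>
        (\<Sum>i\<in>UNIV. (\<lambda>y. lam i *\<^sub>R y) ` ?df i) + (\<Sum>j\<in>{1..q}. (\<lambda>y. mu j *\<^sub>R y) ` ?dg j)"
      and compl: "\<And>j. j \<in> {1..q} \<Longrightarrow> ereal (mu j) * worst_value (V j) (g j) xbar = 0"
      unfolding highly_robust_KKT_def by blast
    from incl obtain s t where s: "\<And>i. s i \<in> (\<lambda>y. lam i *\<^sub>R y) ` ?df i"
      and t: "\<And>j. j \<in> {1..q} \<Longrightarrow> t j \<in> (\<lambda>y. mu j *\<^sub>R y) ` ?dg j"
      and eq: "(\<Sum>i\<in>UNIV. lam i *\<^sub>R (u $ i)) = sum s UNIV + sum t {1..q}"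
      unfolding set_plus_def set_sum_alt[OF finite] set_sum_alt[OF finite_atLeastAtMost] by blast
    from s obtain \<xi> where \<xi>: "\<And>i. \<xi> i \<in> ?df i" "\<And>i. s i = lam i *\<^sub>R \<xi> i"
      by (simp add: image_iff Bex_def) metis
    from t obtain \<eta> where \<eta>: "\<And>j. j \<in> {1..q} \<Longrightarrow> \<eta> j \<in> ?dg j"
      "\<And>j. j \<in> {1..q} \<Longrightarrow> t j = mu j *\<^sub>R \<eta> j"
      by (simp add: image_iff Bex_def) metis
    from glc[OF x u] obtain d where
      d_obj: "\<And>i xs. xs \<in> subdifferential (\<lambda>y. ereal (perturbed f y u $ i)) xbar \<Longrightarrow>
        blinfun_apply xs d \<le> perturbed f x u $ i - perturbed f xbar u $ i"
      and d_con: "\<And>j v xs. j \<in> {1..q} \<Longrightarrow> v \<in> active_set (V j) (g j) xbar \<Longrightarrow>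
        xs \<in> subdifferential (\<lambda>y. g j y v) xbar \<Longrightarrow>
        ereal (blinfun_apply xs d) \<le> g j x v - g j xbar v"
      by blast
    have "blinfun_apply (\<xi> i - u $ i) d < 0" for i
    proof -
      have "\<xi> i - u $ i \<in> subdifferential (\<lambda>y. ereal (perturbed f y u $ i)) xbar"
        using subdifferential_tilt[OF \<xi>(1), of i "u $ i"] by (simp add: perturbed_def)
      from d_obj[OF this] better show ?thesis
        by (simp add: vec_less_def) (metis diff_less_0_iff_less order_le_less_trans)
    qed
    then have obj: "(\<Sum>i\<in>UNIV. lam i * blinfun_apply (\<xi> i - u $ i) d) < 0"
      using lam by (intro sum_convex_weights_neg) auto
    have con: "(\<Sum>j\<in>{1..q}. mu j * blinfun_apply (\<eta> j) d) \<le> 0"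
    proof (rule sum_nonpos)
      fix j assume j: "j \<in> {1..q}"
      show "mu j * blinfun_apply (\<eta> j) d \<le> 0"
      proof (rule multiplier_times_active_subgradient_nonpos
          [OF mu[OF j] compl[OF j] _ _ \<eta>(1)[OF j]])
        show "g j x v \<le> 0" if "v \<in> topspace (V j)" for v
          using x j that by (auto simp: robust_feasible_def)
      qed (rule d_con[OF j])
    qed
    have "(\<Sum>i\<in>UNIV. lam i * blinfun_apply (u $ i) d)
        = (\<Sum>i\<in>UNIV. lam i * blinfun_apply (\<xi> i) d) + (\<Sum>j\<in>{1..q}. mu j * blinfun_apply (\<eta> j) d)"
      using arg_cong[OF eq, of "\<lambda>xs. blinfun_apply xs d"] \<xi>(2) \<eta>(2)
      by (simp add: blinfun.sum_left blinfun.add_left blinfun.scaleR_left)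
    with obj con show False
      by (simp add: blinfun.diff_left right_diff_distrib sum_subtractf)
  qed
  with B assms(6) show ?thesis
    unfolding local_highly_robust_weakly_efficient_def by blast
qed

end
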